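(* Let $N\ge 1$ be an integer, let $X\subseteq\mathbb{R}^n$ be a nonempty closed convex set and let $f$ be a convex function whose domain contains $X$, with $\partial f(x)\neq\emptyset$ for every $x\in X$. Let $h_1,\dots,h_N>0$ be step sizes, let $\hat x\in X$, let $h_{N+1}>0$, and let $0<v_0\le v_1\le\dots\le v_N\le v_{N+1}$ be real numbers. Let $x^1\in X$, let $g^k\in\partial f(x^k)$ for $k\in\{1,\dots,N+1\}$, and let $x^{k+1}=P_X(x^k-h_kg^k)$ for $k\in\{1,\dots,N\}$. Then $$\sum_{k=1}^{N+1}\left(h_kv_k^2-(v_k-v_{k-1})\sum_{i=k}^{N+1}h_iv_i\right)f(x^k)-v_0\sum_{k=1}^{N+1}h_kv_k\,f(\hat x)\le \frac{v_0^2}{2}\|x^1-\hat x\|^2+\frac12\sum_{k=1}^{N+1}h_k^2v_k^2\|g^k\|^2 .$$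
   Context: $\|\cdot\|$ is the Euclidean norm on $\mathbb{R}^n$ and $P_X$ is the Euclidean projection onto $X$. The subdifferential is $\partial f(x)=\{g\in\mathbb{R}^n : f(y)\ge f(x)+\langle g,y-x\rangle \text{ for all } y\in\mathrm{dom} f\}$. *)

theory Defs
  imports "HOL-Analysis.Analysis"
begin

(* A convex function with effective domain D is represented by the set D together with a
   real-valued f satisfying convex_on D f; values of f outside D carry no meaning. *)
definition subdifferential ::
    "(real ^ 'n) set \<Rightarrow> (real ^ 'n \<Rightarrow> real) \<Rightarrow> real ^ 'n \<Rightarrow> (real ^ 'n) set" where
  "subdifferential D f x = {g. \<forall>y\<in>D. f y \<ge> f x + g \<bullet> (y - x)}"

end

theory Submission
  imports Defs
begin

text \<open>
  Instead of comparing every iterate with the fixed point \<open>xhat\<close>, one compares \<open>x k\<close> with the moving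
  reference point \<open>z k\<close>, a convex combination of \<open>z (k - 1)\<close> and \<open>x k\<close> chosen such that
  \<open>v k * (x k - z k) = v (k - 1) * (x k - z (k - 1))\<close>. Multiplying the usual projected subgradient
  estimate by \<open>(v k)\<^sup>2\<close> then makes the distance terms telescope, and convexity bounds \<open>v k * f (z k)\<close>
  by \<open>v 0 * f xhat\<close> plus the increments \<open>(v j - v (j - 1)) * f (x j)\<close> with \<open>j \<le> k\<close>; exchanging the
  order of summation gives the claim.
\<close>

text \<open>Unrolled, \<open>z k = moving_ref v x y k\<close> satisfies \<open>v k * z k = v 0 * y +
  (\<Sum>j=1..k. (v j - v (j - 1)) * x j)\<close> as long as the \<open>v j\<close> are nonzero: the
  starting point keeps weight \<open>v 0\<close>, and each \<open>x j\<close> enters with the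
  increment of \<open>v\<close>.\<close>

primrec moving_ref :: "(nat \<Rightarrow> real) \<Rightarrow> (nat \<Rightarrow> 'a::real_vector) \<Rightarrow> 'a \<Rightarrow> nat \<Rightarrow> 'a" where
  "moving_ref v x y 0 = y"
| "moving_ref v x y (Suc k) =
    (1 - v k / v (Suc k)) *\<^sub>R x (Suc k) + (v k / v (Suc k)) *\<^sub>R moving_ref v x y k"

lemma moving_ref_diff:
  assumes "v (Suc k) \<noteq> 0"
  shows "v (Suc k) *\<^sub>R (x (Suc k) - moving_ref v x y (Suc k)) = v k *\<^sub>R (x (Suc k) - moving_ref v x y k)"
  using assms by (simp add: algebra_simps)

lemma positive_of_nondecreasing:
  fixes v :: "nat \<Rightarrow> real"
  assumes "v 0 > 0" and "\<And>k. k < M \<Longrightarrow> v k \<le> v (Suc k)" and "m \<le> M"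
  shows "v m > 0"
  using assms(3)
proof (induction m)
  case (Suc m)
  then show ?case using assms(2)[of m] by simp
qed (use assms(1) in simp)

text \<open>Positivity and monotonicity of \<open>v\<close> put the ratio
  \<open>v k / v (Suc k)\<close> in (0,1], so each recursion step is a convex combination of points
  of \<open>X\<close>.\<close>

lemma moving_ref_mem:
  assumes "convex X" and "y \<in> X" and "v 0 > 0" and "\<And>k. k < M \<Longrightarrow> v k \<le> v (Suc k)"
    and "\<And>k. k < M \<Longrightarrow> x (Suc k) \<in> X" and "m \<le> M"
  shows "moving_ref v x y m \<in> X"
  using assms(6)
proof (induction m)
  case (Suc m)
  have "v m > 0" "v (Suc m) > 0"
    using positive_of_nondecreasing[of v M] assms(3,4) Suc.prems by auto
  moreover have "v m \<le> v (Suc m)" using assms(4) Suc.prems by simp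
  ultimately show ?case
    unfolding moving_ref.simps using assms(5) Suc
    by (intro convexD[OF assms(1)]) auto
qed (use assms(2) in simp)

text \<open>This is Jensen's inequality for the unrolled form of the reference point, multiplied by
  the total weight \<open>v m\<close>. It is proved one binary combination at a time.\<close>

lemma convex_on_moving_ref:
  assumes "convex_on D f" and "y \<in> D" and "v 0 > 0" and "\<And>k. k < M \<Longrightarrow> v k \<le> v (Suc k)"
    and "\<And>k. k < M \<Longrightarrow> x (Suc k) \<in> D" and "m \<le> M"
  shows "v m * f (moving_ref v x y m) \<le> v 0 * f y + (\<Sum>j=1..m. (v j - v (j - 1)) * f (x j))"
  using assms(6)
proof (induction m)
  case (Suc m)
  have pos: "v m > 0" "v (Suc m) > 0"
    using positive_of_nondecreasing[of v M] assms(3,4) Suc.prems by auto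
  have le: "v m \<le> v (Suc m)" using assms(4) Suc.prems by simp
  have "moving_ref v x y m \<in> D"
    using moving_ref_mem[where v=v and x=x and M=M, OF convex_on_imp_convex[OF assms(1)] assms(2-5)] Suc.prems by simp
  then have "f (moving_ref v x y (Suc m))
      \<le> (1 - v m / v (Suc m)) * f (x (Suc m)) + (v m / v (Suc m)) * f (moving_ref v x y m)"
    unfolding moving_ref.simps using assms(5) Suc.prems pos le
    by (intro convex_onD[OF assms(1), simplified]) auto
  then have "v (Suc m) * f (moving_ref v x y (Suc m))
      \<le> v (Suc m) * ((1 - v m / v (Suc m)) * f (x (Suc m)) + (v m / v (Suc m)) * f (moving_ref v x y m))"
    using pos by simp
  also have "\<dots> = (v (Suc m) - v m) * f (x (Suc m)) + v m * f (moving_ref v x y m)"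
    using pos by (simp add: field_simps)
  finally show ?case using Suc by simp
qed simp

text \<open>The projection is nonexpansive and fixes \<open>z\<close>.\<close>

lemma norm_closest_point_diff_le:
  fixes X :: "'a::euclidean_space set"
  assumes "closed X" "convex X" "z \<in> X"
  shows "norm (closest_point X p - z) \<le> norm (p - z)"
  using closest_point_lipschitz[of X p z] closest_point_self[of z X] assms
  by (auto simp: dist_norm)

text \<open>Drop the projection, expand the square, and bound the cross term by the subgradient
  inequality at \<open>z\<close>. Membership of \<open>z\<close> in \<open>X\<close> serves both the
  first and the last step.\<close>

lemma projected_subgradient_step:
  assumes "closed X" "convex X" "X \<subseteq> D" "z \<in> X" "g \<in> subdifferential D f x" "h \<ge> 0"
  shows "(norm (closest_point X (x - h *\<^sub>R g) - z))\<^sup>2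
    \<le> (norm (x - z))\<^sup>2 - 2 * h * (f x - f z) + h\<^sup>2 * (norm g)\<^sup>2"
proof -
  have "(norm (closest_point X (x - h *\<^sub>R g) - z))\<^sup>2 \<le> (norm (x - h *\<^sub>R g - z))\<^sup>2"
    using norm_closest_point_diff_le[OF assms(1,2,4)] by (intro power_mono) auto
  also have "\<dots> = (norm (x - z))\<^sup>2 - 2 * h * (g \<bullet> (x - z)) + h\<^sup>2 * (norm g)\<^sup>2"
    unfolding power2_norm_eq_inner
    by (simp add: inner_diff inner_commute algebra_simps power2_eq_square)
  finally have "(norm (closest_point X (x - h *\<^sub>R g) - z))\<^sup>2
    \<le> (norm (x - z))\<^sup>2 - 2 * h * (g \<bullet> (x - z)) + h\<^sup>2 * (norm g)\<^sup>2" .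
  moreover have "h * (f x - f z) \<le> h * (g \<bullet> (x - z))"
  proof (rule mult_left_mono[OF _ assms(6)])
    have "f z \<ge> f x + g \<bullet> (z - x)"
      using assms(3-5) by (auto simp: subdifferential_def)
    then show "f x - f z \<le> g \<bullet> (x - z)" by (simp add: inner_diff_right)
  qed
  ultimately show ?thesis by linarith
qed

text \<open>The distance kept on the left pairs the new iterate \<open>x (Suc m)\<close> with the
  old reference point. The next induction step first moves the reference point by rescaling, then
  applies the one-step estimate at the new one.\<close>

lemma projected_subgradient_telescoped:
  fixes x :: "nat \<Rightarrow> real ^ 'n"
  assumes "closed X" "convex X" "X \<subseteq> D" "y \<in> X"
    and "v 0 > 0" "\<And>k. k < M \<Longrightarrow> v k \<le> v (Suc k)"
    and "\<And>k. k < M \<Longrightarrow> x (Suc k) \<in> X"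
    and "\<And>k. k < M \<Longrightarrow> h (Suc k) \<ge> 0"
    and "\<And>k. k < M \<Longrightarrow> g (Suc k) \<in> subdifferential D f (x (Suc k))"
    and "\<And>k. k < M \<Longrightarrow> x (Suc (Suc k)) = closest_point X (x (Suc k) - h (Suc k) *\<^sub>R g (Suc k))"
    and "m \<le> M"
  shows "2 * (\<Sum>k=1..m. h k * (v k)\<^sup>2 * (f (x k) - f (moving_ref v x y k)))
      + (v m)\<^sup>2 * (norm (x (Suc m) - moving_ref v x y m))\<^sup>2
    \<le> (v 0)\<^sup>2 * (norm (x 1 - y))\<^sup>2 + (\<Sum>k=1..m. (h k)\<^sup>2 * (v k)\<^sup>2 * (norm (g k))\<^sup>2)"
  using assms(11)
proof (induction m)
  case (Suc m)
  let ?k = "Suc m" and ?z = "moving_ref v x y"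
  have "v ?k > 0" using positive_of_nondecreasing[of v M] assms(5,6) Suc.prems by auto
  then have "(norm (v ?k *\<^sub>R (x ?k - ?z ?k)))\<^sup>2 = (norm (v m *\<^sub>R (x ?k - ?z m)))\<^sup>2"
    using moving_ref_diff[of v m x y] by simp
  \<comment> \<open>Changing the weight from \<open>v m\<close> to \<open>v (Suc m)\<close> exactly
    compensates for changing the reference point, so no error term arises.\<close>
  then have shift: "(v ?k)\<^sup>2 * (norm (x ?k - ?z ?k))\<^sup>2 = (v m)\<^sup>2 * (norm (x ?k - ?z m))\<^sup>2"
    by (simp add: power_mult_distrib del: moving_ref.simps)
  have "?z ?k \<in> X"
    using moving_ref_mem[where v=v and x=x and M=M, OF assms(2,4-7) Suc.prems] .
  then have "(norm (x (Suc ?k) - ?z ?k))\<^sup>2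
      \<le> (norm (x ?k - ?z ?k))\<^sup>2 - 2 * h ?k * (f (x ?k) - f (?z ?k)) + (h ?k)\<^sup>2 * (norm (g ?k))\<^sup>2"
    using projected_subgradient_step[OF assms(1-3)] assms(8-10) Suc.prems
    by (simp del: moving_ref.simps)
  then have "(v ?k)\<^sup>2 * (norm (x (Suc ?k) - ?z ?k))\<^sup>2
      \<le> (v ?k)\<^sup>2 * ((norm (x ?k - ?z ?k))\<^sup>2 - 2 * h ?k * (f (x ?k) - f (?z ?k)) + (h ?k)\<^sup>2 * (norm (g ?k))\<^sup>2)"
    by (intro mult_left_mono) auto
  also have "\<dots> = (v m)\<^sup>2 * (norm (x ?k - ?z m))\<^sup>2 - 2 * (h ?k * (v ?k)\<^sup>2 * (f (x ?k) - f (?z ?k)))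
      + (h ?k)\<^sup>2 * (v ?k)\<^sup>2 * (norm (g ?k))\<^sup>2"
    unfolding shift[symmetric] by (simp add: algebra_simps del: moving_ref.simps)
  finally have step: "(v ?k)\<^sup>2 * (norm (x (Suc ?k) - ?z ?k))\<^sup>2
      \<le> (v m)\<^sup>2 * (norm (x ?k - ?z m))\<^sup>2 - 2 * (h ?k * (v ?k)\<^sup>2 * (f (x ?k) - f (?z ?k)))
      + (h ?k)\<^sup>2 * (v ?k)\<^sup>2 * (norm (g ?k))\<^sup>2" .
  have IH: "2 * (\<Sum>k=1..m. h k * (v k)\<^sup>2 * (f (x k) - f (?z k))) + (v m)\<^sup>2 * (norm (x ?k - ?z m))\<^sup>2
    \<le> (v 0)\<^sup>2 * (norm (x 1 - y))\<^sup>2 + (\<Sum>k=1..m. (h k)\<^sup>2 * (v k)\<^sup>2 * (norm (g k))\<^sup>2)"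
    using Suc by simp
  have "(\<Sum>k=1..?k. h k * (v k)\<^sup>2 * (f (x k) - f (?z k)))
      = (\<Sum>k=1..m. h k * (v k)\<^sup>2 * (f (x k) - f (?z k))) + h ?k * (v ?k)\<^sup>2 * (f (x ?k) - f (?z ?k))"
    "(\<Sum>k=1..?k. (h k)\<^sup>2 * (v k)\<^sup>2 * (norm (g k))\<^sup>2)
      = (\<Sum>k=1..m. (h k)\<^sup>2 * (v k)\<^sup>2 * (norm (g k))\<^sup>2) + (h ?k)\<^sup>2 * (v ?k)\<^sup>2 * (norm (g ?k))\<^sup>2"
    by (simp_all del: moving_ref.simps)
  with IH step show ?case by linarith
qed simp

lemma sum_mult_partial_sums:
  fixes a b :: "nat \<Rightarrow> 'a::comm_semiring_0"
  shows "(\<Sum>k=1..M. a k * (\<Sum>j=1..k. b j)) = (\<Sum>j=1..M. b j * (\<Sum>k=j..M. a k))"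
proof (induction M)
  case (Suc M)
  \<comment> \<open>For \<open>j = Suc M\<close> the sum over \<open>k=j..M\<close> is empty, so
    splitting off \<open>a (Suc M)\<close> is valid on the whole range and that index contributes
    nothing to the remaining double sum.\<close>
  have "(\<Sum>j=1..Suc M. b j * (\<Sum>k=j..Suc M. a k))
      = (\<Sum>j=1..Suc M. b j * ((\<Sum>k=j..M. a k) + a (Suc M)))"
    by (intro sum.cong) auto
  also have "\<dots> = (\<Sum>j=1..M. b j * (\<Sum>k=j..M. a k)) + a (Suc M) * (\<Sum>j=1..Suc M. b j)"
    by (simp add: distrib_left sum.distrib sum_distrib_left mult.commute add.assoc)
  finally show ?case using Suc by simp
qed simp

theorem lemma2p1:
  fixes N :: nat
    and X D :: "(real ^ 'n) set"
    and f :: "real ^ 'n \<Rightarrow> real"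
    and h v :: "nat \<Rightarrow> real"
    and x g :: "nat \<Rightarrow> real ^ 'n"
    and xhat :: "real ^ 'n"
  assumes "N \<ge> 1"
    and "X \<noteq> {}" and "closed X" and "convex X"
    and "convex_on D f" and "X \<subseteq> D"
    and "\<forall>y\<in>X. subdifferential D f y \<noteq> {}"
    and "\<forall>k\<in>{1..N+1}. h k > 0"
    and "xhat \<in> X"
    and "v 0 > 0" and "\<forall>k\<in>{0..N}. v k \<le> v (k + 1)"
    and "x 1 \<in> X"
    and "\<forall>k\<in>{1..N+1}. g k \<in> subdifferential D f (x k)"
    and "\<forall>k\<in>{1..N}. x (k + 1) = closest_point X (x k - h k *\<^sub>R g k)"
  shows "(\<Sum>k=1..N+1. (h k * (v k)\<^sup>2 - (v k - v (k - 1)) * (\<Sum>i=k..N+1. h i * v i)) * f (x k))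
           - v 0 * (\<Sum>k=1..N+1. h k * v k) * f xhat
         \<le> (v 0)\<^sup>2 / 2 * (norm (x 1 - xhat))\<^sup>2
           + 1 / 2 * (\<Sum>k=1..N+1. (h k)\<^sup>2 * (v k)\<^sup>2 * (norm (g k))\<^sup>2)"
proof -
  define M where "M = N + 1"
  \<comment> \<open>The iteration stops at \<open>x (N + 1)\<close>; one further step makes the recursion uniform in \<open>k\<close>.\<close>
  define w where "w = x(Suc M := closest_point X (x M - h M *\<^sub>R g M))"
  define z where "z = moving_ref v w xhat"
  have w_eq: "w k = x k" if "k \<le> M" for k
    using that by (simp add: w_def)
  have w1: "w 1 = x 1" using w_eq[of 1] by (simp add: M_def)
  have v_mono: "v k \<le> v (Suc k)" if "k < M" for k
    using that assms(11) by (simp add: M_def)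
  have h_pos: "h (Suc k) > 0" if "k < M" for k
    using that assms(8) by (simp add: M_def)
  have w_step: "w (Suc (Suc k)) = closest_point X (w (Suc k) - h (Suc k) *\<^sub>R g (Suc k))"
    if "k < M" for k
  proof (cases "Suc k = M")
    case False
    then show ?thesis using that assms(14) by (simp add: w_def M_def)
  qed (simp add: w_def)
  have w_mem: "w (Suc k) \<in> X" if "k < M" for k
  proof (cases k)
    case 0
    then show ?thesis using assms(12) w1 by simp
  next
    case (Suc j)
    then show ?thesis using that w_step[of j] closest_point_in_set[OF assms(3,2)] by simp
  qed
  have w_sub: "g (Suc k) \<in> subdifferential D f (w (Suc k))" if "k < M" for k
    using that assms(13) w_eq[of "Suc k"] by (simp add: M_def)
  let ?S = "\<Sum>k=1..M. (h k)\<^sup>2 * (v k)\<^sup>2 * (norm (g k))\<^sup>2"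
  have "2 * (\<Sum>k=1..M. h k * (v k)\<^sup>2 * (f (w k) - f (z k))) + (v M)\<^sup>2 * (norm (w (Suc M) - z M))\<^sup>2
      \<le> (v 0)\<^sup>2 * (norm (x 1 - xhat))\<^sup>2 + ?S"
    unfolding z_def w1[symmetric]
    by (rule projected_subgradient_telescoped[where v=v and x=w and h=h and g=g and M=M and m=M,
          OF assms(3,4,6,9,10) v_mono w_mem less_imp_le[OF h_pos]
          w_sub w_step order_refl])
  \<comment> \<open>The artificial point \<open>w (Suc M)\<close> occurs only in this term, so
    dropping it leaves a bound on the original iterates.\<close>
  moreover have "(v M)\<^sup>2 * (norm (w (Suc M) - z M))\<^sup>2 \<ge> 0" by simp
  ultimately have tele: "(\<Sum>k=1..M. h k * (v k)\<^sup>2 * (f (w k) - f (z k)))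
      \<le> (v 0)\<^sup>2 / 2 * (norm (x 1 - xhat))\<^sup>2 + 1 / 2 * ?S"
    by linarith
  define b where "b j = (v j - v (j - 1)) * f (w j)" for j
  have conv: "v k * f (z k) \<le> v 0 * f xhat + (\<Sum>j=1..k. b j)" if "k \<le> M" for k
    unfolding z_def b_def
    using that assms(6,9) w_mem by (intro convex_on_moving_ref[OF assms(5) _ assms(10) v_mono]) auto
  have hv: "h k * v k \<ge> 0" if "k \<in> {1..M}" for k
  proof -
    have "h k > 0" using that assms(8) by (simp add: M_def)
    moreover have "v k > 0"
      using that positive_of_nondecreasing[of v M k, OF assms(10) v_mono] by simp
    ultimately show ?thesis by simp
  qed
  \<comment> \<open>One factor \<open>v k\<close> goes to \<open>f (z k)\<close> to match
    \<open>conv\<close>; the other stays in the nonnegative multiplier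
    \<open>h k * v k\<close>.\<close>
  have "(\<Sum>k=1..M. h k * (v k)\<^sup>2 * f (z k)) = (\<Sum>k=1..M. (h k * v k) * (v k * f (z k)))"
    by (simp add: power2_eq_square mult.assoc)
  also have "\<dots> \<le> (\<Sum>k=1..M. (h k * v k) * (v 0 * f xhat + (\<Sum>j=1..k. b j)))"
    using conv hv by (intro sum_mono mult_left_mono) auto
  also have "\<dots> = v 0 * (\<Sum>k=1..M. h k * v k) * f xhat + (\<Sum>k=1..M. (h k * v k) * (\<Sum>j=1..k. b j))"
    by (simp add: distrib_left sum.distrib sum_distrib_left sum_distrib_right mult_ac)
  also have "(\<Sum>k=1..M. (h k * v k) * (\<Sum>j=1..k. b j)) = (\<Sum>j=1..M. b j * (\<Sum>k=j..M. h k * v k))"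
    by (rule sum_mult_partial_sums)
  finally have swap: "(\<Sum>k=1..M. h k * (v k)\<^sup>2 * f (z k))
      \<le> v 0 * (\<Sum>k=1..M. h k * v k) * f xhat + (\<Sum>j=1..M. b j * (\<Sum>k=j..M. h k * v k))" .
  \<comment> \<open>Adding and subtracting the terms \<open>f (z k)\<close> leaves one sum bounded
    by \<open>tele\<close> and one bounded by \<open>swap\<close>; the double sum in
    \<open>swap\<close> cancels the one subtracted here.\<close>
  have "(\<Sum>k=1..M. (h k * (v k)\<^sup>2 - (v k - v (k - 1)) * (\<Sum>i=k..M. h i * v i)) * f (x k))
      = (\<Sum>k=1..M. h k * (v k)\<^sup>2 * f (w k) - b k * (\<Sum>i=k..M. h i * v i))"
    by (intro sum.cong) (auto simp: b_def w_eq algebra_simps)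
  also have "\<dots> = (\<Sum>k=1..M. h k * (v k)\<^sup>2 * (f (w k) - f (z k))) + (\<Sum>k=1..M. h k * (v k)\<^sup>2 * f (z k))
      - (\<Sum>k=1..M. b k * (\<Sum>i=k..M. h i * v i))"
    by (simp add: sum_subtractf right_diff_distrib)
  finally show ?thesis
    using tele swap unfolding M_def by linarith
qed

end
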